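(* Let $G$ be a game structure over a full binary tree of height $k$, let $\varepsilon=\frac{1}{R\,2^k}$ with $R\ge 4$ an even integer, and let $(B_1,B_2)$ be an initial budget partition with $B_1\in\mathcal B_\varepsilon$, $B_2=1-B_1$. Then the outcome under initial budgets $(B_1,B_2)$ of any pure subgame-perfect equilibrium (PSPE) of $\langle G,\varepsilon\rangle$ satisfies the $(B_1,B_2)$-satisfaction test; that is, for $i=1,2$, player $i$ weakly prefers this outcome to at least $\lceil B_i|T|\rceil$ of the outcomes in $T$.
   Context: A game structure over a full binary tree of height $k$ is $G=\langle S,s_0,T,g,u_1,u_2\rangle$ where $S$ is the node set of a rooted tree with root $s_0$, every nonterminal $s\in S\setminus T$ has exactly two children, forming $g(s)$, the terminals $T$ are the $2^k$ leaves, all at depth $k$, and $u_i:T\to\mathbb R$, $i=1,2$. Preferences: $t\succ_i t'$ iff $u_i(t)>u_i(t')$, or $u_i(t)=u_i(t')$ and $u_{-i}(t)>u_{-i}(t')$, where $-i$ is the other player; player $i$ weakly prefers $t$ to $t'$ if not $t'\succ_i t$ (in particular each terminal is weakly preferred to itself). Bidding game $\langle G,\varepsilon\rangle$: budgets and bids are in $\mathcal B_\varepsilon=\{0,\varepsilon,\dots,1\}$. At $s\in S\setminus T$ with budgets $(B_1,B_2)$, $B_1+B_2=1$, each player $i$ simultaneously submits a bid $b_i\le B_i$ and a next state $s_i^*\in g(s)$. The higher bidder wins (ties won by player 1), pays her bid to the other player, and the game moves to the winner's selected state with the updated budgets, until a terminal is reached. A strategy profile specifies bids and next states for all $s\in S\setminus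 T$ and all budget partitions. It is a PSPE if for every state and budget partition each player best-responds to the other (with respect to $\succ_i$ on the terminal reached) in the subgame starting there. An outcome $t$ satisfies the $(\alpha_1,\alpha_2)$-satisfaction test if each player $i$ weakly prefers $t$ to at least $\lceil\alpha_i|T|\rceil$ outcomes in $T$. *)

theory Defs
  imports Complex_Main "HOL-Library.While_Combinator"
begin

datatype player = P1 | P2

fun opponent :: "player \<Rightarrow> player" where
  "opponent P1 = P2"
| "opponent P2 = P1"

text \<open>Only the values of \<open>children\<close> on nonterminal states and of \<open>utility\<close> on terminals
  are meaningful.\<close>

record 's game =
  states :: "'s set"
  root_state :: 's
  terminals :: "'s set"
  children :: "'s \<Rightarrow> 's set"
  utility :: "player \<Rightarrow> 's \<Rightarrow> real"

definition edges :: "'s game \<Rightarrow> ('s \<times> 's) set" where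
  "edges G = {(s, s'). s \<in> states G - terminals G \<and> s' \<in> children G s}"

definition rooted_tree :: "'s game \<Rightarrow> bool" where
  "rooted_tree G \<longleftrightarrow>
     finite (states G) \<and>
     root_state G \<in> states G \<and>
     terminals G \<subseteq> states G \<and>
     edges G \<subseteq> states G \<times> states G \<and>
     root_state G \<notin> Range (edges G) \<and>
     (\<forall>s \<in> states G - {root_state G}. \<exists>!p. (p, s) \<in> edges G) \<and>
     (\<forall>s \<in> states G. (root_state G, s) \<in> (edges G)\<^sup>*)"

definition full_binary_game :: "nat \<Rightarrow> 's game \<Rightarrow> bool" where
  "full_binary_game k G \<longleftrightarrow>
     rooted_tree G \<and>
     (\<forall>s \<in> states G - terminals G. card (children G s) = 2) \<and>
     card (terminals G) = 2 ^ k \<and>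
     (\<forall>t \<in> terminals G. (root_state G, t) \<in> edges G ^^ k)"

definition prefers :: "'s game \<Rightarrow> player \<Rightarrow> 's \<Rightarrow> 's \<Rightarrow> bool" where
  "prefers G i t t' \<longleftrightarrow>
     utility G i t > utility G i t' \<or>
     utility G i t = utility G i t' \<and>
       utility G (opponent i) t > utility G (opponent i) t'"

definition weakly_prefers :: "'s game \<Rightarrow> player \<Rightarrow> 's \<Rightarrow> 's \<Rightarrow> bool" where
  "weakly_prefers G i t t' \<longleftrightarrow> \<not> prefers G i t' t"

definition budget_set :: "real \<Rightarrow> real set" where
  "budget_set \<epsilon> = {b. (\<exists>n::nat. b = real n * \<epsilon>) \<and> b \<le> 1}"

definition budget_partition :: "real \<Rightarrow> (player \<Rightarrow> real) \<Rightarrow> bool" where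
  "budget_partition \<epsilon> B \<longleftrightarrow> (\<forall>i. B i \<in> budget_set \<epsilon>) \<and> B P1 + B P2 = 1"

text \<open>A strategy maps a state and a budget partition to a bid and a selected next state.\<close>

type_synonym 's strategy = "'s \<Rightarrow> (player \<Rightarrow> real) \<Rightarrow> real \<times> 's"

definition valid_strategy :: "'s game \<Rightarrow> real \<Rightarrow> player \<Rightarrow> 's strategy \<Rightarrow> bool" where
  "valid_strategy G \<epsilon> i \<tau> \<longleftrightarrow>
     (\<forall>s \<in> states G - terminals G. \<forall>B. budget_partition \<epsilon> B \<longrightarrow>
        fst (\<tau> s B) \<in> budget_set \<epsilon> \<and> fst (\<tau> s B) \<le> B i \<and> snd (\<tau> s B) \<in> children G s)"

definition winner :: "(player \<Rightarrow> real) \<Rightarrow> player" where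
  "winner b = (if b P1 \<ge> b P2 then P1 else P2)"

definition pay :: "player \<Rightarrow> real \<Rightarrow> (player \<Rightarrow> real) \<Rightarrow> (player \<Rightarrow> real)" where
  "pay w x B = B(w := B w - x, opponent w := B (opponent w) + x)"

fun step ::
  "(player \<Rightarrow> 's strategy) \<Rightarrow> 's \<times> (player \<Rightarrow> real) \<Rightarrow> 's \<times> (player \<Rightarrow> real)" where
  "step \<sigma> (s, B) =
     (let w = winner (\<lambda>i. fst (\<sigma> i s B))
      in (snd (\<sigma> w s B), pay w (fst (\<sigma> w s B)) B))"

definition outcome ::
  "'s game \<Rightarrow> (player \<Rightarrow> 's strategy) \<Rightarrow> 's \<Rightarrow> (player \<Rightarrow> real) \<Rightarrow> 's" where
  "outcome G \<sigma> s B = fst (while (\<lambda>(s, B). s \<notin> terminals G) (step \<sigma>) (s, B))"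

text \<open>In the tree a play never returns to an earlier state, so deviations in the subgame at
  \<open>(s, B)\<close> can be taken from the strategies on all of \<open>G\<close>: what a deviation
  prescribes outside that subgame does not affect the outcome.\<close>

definition pspe :: "'s game \<Rightarrow> real \<Rightarrow> (player \<Rightarrow> 's strategy) \<Rightarrow> bool" where
  "pspe G \<epsilon> \<sigma> \<longleftrightarrow>
     (\<forall>i. valid_strategy G \<epsilon> i (\<sigma> i)) \<and>
     (\<forall>s \<in> states G. \<forall>B. budget_partition \<epsilon> B \<longrightarrow>
        (\<forall>i \<tau>. valid_strategy G \<epsilon> i \<tau> \<longrightarrow>
           \<not> prefers G i (outcome G (\<sigma>(i := \<tau>)) s B) (outcome G \<sigma> s B)))"

definition satisfaction_test :: "'s game \<Rightarrow> (player \<Rightarrow> real) \<Rightarrow> 's \<Rightarrow> bool" where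
  "satisfaction_test G \<alpha> t \<longleftrightarrow>
     (\<forall>i. int (card {t' \<in> terminals G. weakly_prefers G i t t'})
            \<ge> \<lceil>\<alpha> i * real (card (terminals G))\<rceil>)"

end

theory Submission imports Defs begin

text \<open>The Richman threshold of a set \<open>L\<close> of leaves is at each node the fraction of the leaves
  below it that belong to \<open>L\<close>. A player whose budget exceeds the threshold at the root can avoid
  \<open>L\<close>: she bids half of the difference between the thresholds of the two children and selects
  the child with the smaller one; whether she wins or loses the bidding, her budget exceeds the
  threshold of the next node.
  If \<open>B\<^sub>i > 0\<close>, fewer than \<open>B\<^sub>i|T|\<close> outcomes have rank below \<open>\<lceil>B\<^sub>i|T|\<rceil>\<close>, so player
  \<open>i\<close> can avoid all of them, and so does every outcome of best responses.\<close>

section \<open>Preferences and ranks of outcomes\<close>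

lemma not_prefers_trans:
  "\<not> prefers G i a b \<Longrightarrow> \<not> prefers G i b c \<Longrightarrow> \<not> prefers G i a c"
  by (auto simp: prefers_def)

lemma not_prefers_refl: "\<not> prefers G i a a"
  by (auto simp: prefers_def)

lemma not_prefers_total: "\<not> prefers G i a b \<or> \<not> prefers G i b a"
  by (auto simp: prefers_def)

lemma exists_most_preferred:
  assumes "finite A" "A \<noteq> {}"
  shows "\<exists>a \<in> A. \<forall>b \<in> A. weakly_prefers G i a b"
  using assms
proof (induction A rule: finite_ne_induct)
  case (singleton x)
  then show ?case by (simp add: weakly_prefers_def not_prefers_refl)
next
  case (insert x F)
  then obtain a where "a \<in> F" "\<forall>b \<in> F. \<not> prefers G i b a"
    by (auto simp: weakly_prefers_def)
  then show ?case
    using not_prefers_trans[of G i _ a x] not_prefers_total[of G i a x]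
    by (auto simp: weakly_prefers_def not_prefers_refl)
qed

text \<open>The outcomes that fail the satisfaction test of player \<open>i\<close> at count
  \<open>m\<close>: the set she has to avoid.\<close>

definition low_ranked :: "'s game \<Rightarrow> player \<Rightarrow> nat \<Rightarrow> 's set" where
  "low_ranked G i m =
     {t \<in> terminals G. card {t' \<in> terminals G. weakly_prefers G i t t'} < m}"

text \<open>A most preferred element \<open>a\<close> of the set weakly beats the whole set, so the
  set lies among the outcomes weakly below \<open>a\<close>; these are fewer than \<open>m\<close>,
  as \<open>a\<close> is itself low-ranked.\<close>

lemma card_low_ranked:
  assumes "finite (terminals G)" "m > 0"
  shows "card (low_ranked G i m) < m"
proof (cases "low_ranked G i m = {}")
  case True
  then show ?thesis using assms by simp
next
  case False
  have "finite (low_ranked G i m)"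
    using assms by (auto simp: low_ranked_def)
  then obtain a where a: "a \<in> low_ranked G i m" "\<forall>b \<in> low_ranked G i m. weakly_prefers G i a b"
    using exists_most_preferred[OF _ False] by blast
  then have "low_ranked G i m \<subseteq> {t' \<in> terminals G. weakly_prefers G i a t'}"
    by (auto simp: low_ranked_def)
  then have "card (low_ranked G i m) \<le> card {t' \<in> terminals G. weakly_prefers G i a t'}"
    using assms by (intro card_mono) auto
  also have "\<dots> < m" using a(1) by (simp add: low_ranked_def)
  finally show ?thesis .
qed

text \<open>Carries a rank bound from the outcome of a deviation over to the equilibrium
  outcome.\<close>

lemma card_weakly_prefers_mono:
  assumes "finite (terminals G)" "\<not> prefers G i t u"
  shows "card {t' \<in> terminals G. weakly_prefers G i t t'} \<le>
         card {t' \<in> terminals G. weakly_prefers G i u t'}"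
  using assms not_prefers_trans[of G i _ t u]
  by (intro card_mono) (auto simp: weakly_prefers_def)

section \<open>Budgets, payments and single moves\<close>

lemma budget_set_nonneg: "\<epsilon> \<ge> 0 \<Longrightarrow> b \<in> budget_set \<epsilon> \<Longrightarrow> b \<ge> 0"
  by (auto simp: budget_set_def)

lemma budget_set_add:
  "a \<in> budget_set \<epsilon> \<Longrightarrow> b \<in> budget_set \<epsilon> \<Longrightarrow> a + b \<le> 1 \<Longrightarrow> a + b \<in> budget_set \<epsilon>"
  unfolding budget_set_def
  by (auto simp: algebra_simps intro: exI[of _ "_ + _ :: nat"])

lemma budget_set_diff:
  assumes "\<epsilon> > 0" "a \<in> budget_set \<epsilon>" "b \<in> budget_set \<epsilon>" "b \<le> a"
  shows "a - b \<in> budget_set \<epsilon>"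
proof -
  obtain m n :: nat where "a = real m * \<epsilon>" "b = real n * \<epsilon>" "a \<le> 1"
    using assms by (auto simp: budget_set_def)
  moreover have "n \<le> m" using calculation assms by simp
  moreover have "a - b \<le> 1" using assms budget_set_nonneg[of \<epsilon> b] calculation by linarith
  ultimately show ?thesis
    by (auto simp: budget_set_def algebra_simps of_nat_diff intro!: exI[of _ "m - n"])
qed

lemma budget_partition_sum: "budget_partition \<epsilon> B \<Longrightarrow> B i + B (opponent i) = 1"
  by (cases i) (auto simp: budget_partition_def)

lemma opponent_neq: "opponent i \<noteq> i" "i \<noteq> opponent i"
  by (cases i; simp)+

lemma opponent_opponent: "opponent (opponent i) = i"
  by (cases i) auto

lemma neq_imp_opponent: "j \<noteq> i \<Longrightarrow> j = opponent i"
  by (cases i; cases j) auto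

text \<open>The winner can afford \<open>x\<close>, and as the budgets sum to 1, the receiver stays
  at or below 1.\<close>

lemma budget_partition_pay:
  assumes "\<epsilon> > 0" "budget_partition \<epsilon> B" "x \<in> budget_set \<epsilon>" "x \<le> B w"
  shows "budget_partition \<epsilon> (pay w x B)"
proof -
  have B: "B j \<in> budget_set \<epsilon>" for j using assms by (auto simp: budget_partition_def)
  have "B w - x \<in> budget_set \<epsilon>" using assms B budget_set_diff by blast
  moreover have "B (opponent w) + x \<in> budget_set \<epsilon>"
    using budget_set_add[OF B assms(3)] budget_partition_sum[OF assms(2), of w] assms(4) by auto
  ultimately show ?thesis
    using assms(2)
    by (cases w) (auto simp: budget_partition_def pay_def)
qed

lemma winner_bid: "b (opponent (winner b)) \<le> b (winner b)"
  by (auto simp: winner_def)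

lemma outcome_terminal: "s \<in> terminals G \<Longrightarrow> outcome G \<sigma> s B = s"
  by (simp add: outcome_def while_unfold)

text \<open>\<open>while_unfold\<close> is an unconditional equation; that the plays in question end
  comes out of the induction on the remaining depth in
  \<open>avoiding_strategy_avoids\<close>.\<close>

lemma outcome_step:
  "s \<notin> terminals G \<Longrightarrow> outcome G \<sigma> s B = outcome G \<sigma> (fst (step \<sigma> (s, B))) (snd (step \<sigma> (s, B)))"
  unfolding outcome_def by (subst while_unfold) simp

section \<open>Depth and descendants in the tree\<close>

locale full_binary_tree =
  fixes G :: "'s game" and k :: nat
  assumes full_binary: "full_binary_game k G"
begin

lemma tree: "rooted_tree G"
  using full_binary by (simp add: full_binary_game_def)

lemma finite_terminals: "finite (terminals G)"
  using tree finite_subset by (auto simp: rooted_tree_def)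

lemma unique_parent: "(p, s) \<in> edges G \<Longrightarrow> (q, s) \<in> edges G \<Longrightarrow> p = q"
  using tree unfolding rooted_tree_def by blast

lemma edge_states: "(p, s) \<in> edges G \<Longrightarrow> p \<in> states G \<and> s \<in> states G"
  using tree unfolding rooted_tree_def by blast

text \<open>Two paths to \<open>s\<close> can be traced back in parallel through unique parents;
  since the root has no parent, they reach it at the same time.\<close>

lemma unique_depth:
  "(root_state G, s) \<in> edges G ^^ m \<Longrightarrow> (root_state G, s) \<in> edges G ^^ n \<Longrightarrow> m = n"
proof (induction m arbitrary: n s)
  case 0
  then show ?case using tree by (cases n) (auto simp: rooted_tree_def)
next
  case (Suc m)
  then obtain p where p: "(root_state G, p) \<in> edges G ^^ m" "(p, s) \<in> edges G" by auto
  then obtain n' where n: "n = Suc n'"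
    using Suc.prems(2) tree by (cases n) (auto simp: rooted_tree_def)
  with Suc.prems obtain q where q: "(root_state G, q) \<in> edges G ^^ n'" "(q, s) \<in> edges G" by auto
  with p unique_parent have "p = q" by blast
  with Suc.IH p q n show ?case by blast
qed

definition depth :: "'s \<Rightarrow> nat" where
  "depth s = (THE d. (root_state G, s) \<in> edges G ^^ d)"

lemma depth_eq: "(root_state G, s) \<in> edges G ^^ d \<Longrightarrow> depth s = d"
  unfolding depth_def using unique_depth by blast

lemma path_of_depth: "s \<in> states G \<Longrightarrow> (root_state G, s) \<in> edges G ^^ depth s"
  using tree depth_eq unfolding rooted_tree_def by (metis rtrancl_imp_relpow)

lemma depth_root: "depth (root_state G) = 0"
  by (rule depth_eq) simp

lemma depth_edge: "(s, c) \<in> edges G \<Longrightarrow> depth c = Suc (depth s)"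
  using edge_states path_of_depth by (intro depth_eq) auto

lemma depth_rtrancl: "(s, t) \<in> (edges G)\<^sup>* \<Longrightarrow> s = t \<or> depth s < depth t"
  by (induction rule: rtrancl_induct) (auto dest: depth_edge)

lemma depth_terminal: "t \<in> terminals G \<Longrightarrow> depth t = k"
  using full_binary by (intro depth_eq) (simp add: full_binary_game_def)

lemma two_children:
  assumes "s \<in> states G - terminals G"
  obtains x y where "children G s = {x, y}" "x \<noteq> y" "(s, x) \<in> edges G" "(s, y) \<in> edges G"
proof -
  have "card (children G s) = 2" using full_binary assms by (auto simp: full_binary_game_def)
  then obtain x y where "children G s = {x, y}" "x \<noteq> y" by (auto simp: card_2_iff)
  with that assms show thesis by (auto simp: edges_def)
qed

text \<open>Depth grows along edges, so the finite edge relation is acyclic and descending through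
  children must stop, which happens only at a terminal.\<close>

lemma terminal_below: "s \<in> states G \<Longrightarrow> \<exists>t \<in> terminals G. (s, t) \<in> (edges G)\<^sup>*"
proof -
  have "finite (edges G)"
    using tree finite_subset[of "edges G" "states G \<times> states G"] by (auto simp: rooted_tree_def)
  moreover have "acyclic (edges G)"
    unfolding acyclic_def using depth_rtrancl depth_edge
    by (metis Suc_n_not_le_n less_or_eq_imp_le tranclD)
  ultimately have "wf ((edges G)\<inverse>)" by (rule finite_acyclic_wf_converse)
  then show "s \<in> states G \<Longrightarrow> ?thesis"
  proof (induction s)
    case (less s)
    show ?case
    proof (cases "s \<in> terminals G")
      case False
      with less.prems obtain x where x: "(s, x) \<in> edges G" using two_children by blast
      with less.IH edge_states obtain t where "t \<in> terminals G" "(x, t) \<in> (edges G)\<^sup>*" by blast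
      with x show ?thesis by (meson converse_rtrancl_into_rtrancl)
    qed auto
  qed
qed

text \<open>A leaf, of depth \<open>k\<close>, lies properly below \<open>s\<close>. This keeps the
  truncated subtraction in \<open>k - depth s\<close> exact.\<close>

lemma depth_nonterminal: "s \<in> states G - terminals G \<Longrightarrow> depth s < k"
  using terminal_below[of s] depth_rtrancl depth_terminal by fastforce

section \<open>Counting marked leaves below a node\<close>

definition count_below :: "'s set \<Rightarrow> 's \<Rightarrow> nat" where
  "count_below L s = card {t \<in> L. (s, t) \<in> (edges G)\<^sup>*}"

text \<open>The ancestors of a node form a chain: a nonempty path from \<open>y\<close> to
  \<open>v\<close> passes through the unique parent \<open>u\<close> of \<open>v\<close>, where the
  induction hypothesis applies.\<close>

lemma common_descendant:
  assumes "(x, t) \<in> (edges G)\<^sup>*" "(y, t) \<in> (edges G)\<^sup>*"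
  shows "(x, y) \<in> (edges G)\<^sup>* \<or> (y, x) \<in> (edges G)\<^sup>*"
  using assms
proof (induction rule: rtrancl_induct)
  case (step u v)
  from step.prems step.hyps step.IH show ?case
    by (cases rule: rtranclE) (auto dest: unique_parent intro: rtrancl_into_rtrancl)
qed auto

lemma count_below_children:
  assumes "s \<in> states G - terminals G" "L \<subseteq> terminals G"
    and xy: "children G s = {x, y}" "x \<noteq> y"
  shows "count_below L s = count_below L x + count_below L y"
proof -
  have e: "(s, x) \<in> edges G" "(s, y) \<in> edges G" using assms by (auto simp: edges_def)
  have "{t \<in> L. (s, t) \<in> (edges G)\<^sup>*} =
      {t \<in> L. (x, t) \<in> (edges G)\<^sup>*} \<union> {t \<in> L. (y, t) \<in> (edges G)\<^sup>*}" (is "_ = ?X \<union> ?Y")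
  proof -
    have "(x, t) \<in> (edges G)\<^sup>* \<or> (y, t) \<in> (edges G)\<^sup>*" if "(s, t) \<in> (edges G)\<^sup>*" "t \<in> L" for t
      using that(1)
    proof (cases rule: converse_rtranclE)
      \<comment> \<open>The empty path would put \<open>s\<close> itself into \<open>L\<close>, but
        \<open>s\<close> is not terminal.\<close>
      case base
      then show ?thesis using that assms by auto
    next
      case (step z)
      then show ?thesis using xy by (auto simp: edges_def)
    qed
    then show ?thesis using e by (auto intro: converse_rtrancl_into_rtrancl)
  qed
  \<comment> \<open>A shared leaf would place one sibling below the other, although their depths
    agree.\<close>
  moreover have "?X \<inter> ?Y = {}"
    using common_descendant depth_rtrancl[of x y] depth_rtrancl[of y x] e xy(2)
    by (fastforce dest: depth_edge)
  moreover have "finite ?X" "finite ?Y"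
    using assms(2) finite_terminals by (auto intro: finite_subset)
  ultimately show ?thesis by (simp add: count_below_def card_Un_disjoint)
qed

lemma count_below_root: "L \<subseteq> terminals G \<Longrightarrow> count_below L (root_state G) = card L"
  using tree by (auto simp: count_below_def rooted_tree_def intro!: arg_cong[of _ _ card])

lemma count_below_terminal:
  "t \<in> L \<Longrightarrow> L \<subseteq> terminals G \<Longrightarrow> count_below L t > 0"
  using finite_terminals finite_subset[of "{u \<in> L. (t, u) \<in> (edges G)\<^sup>*}" "terminals G"]
  by (auto simp: count_below_def card_gt_0_iff)

section \<open>Thresholds and the avoiding strategy\<close>

text \<open>The denominator is the number of leaves below \<open>s\<close>.\<close>

definition threshold :: "'s set \<Rightarrow> 's \<Rightarrow> real" where
  "threshold L s = real (count_below L s) / 2 ^ (k - depth s)"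

text \<open>Siblings have the same denominator, so the smaller count is the smaller
  threshold.\<close>

definition best_child :: "'s set \<Rightarrow> 's \<Rightarrow> 's" where
  "best_child L s = arg_min_on (count_below L) (children G s)"

text \<open>As the threshold of a node is the mean of those of its children, this bid is half of the
  difference of the latter.\<close>

definition avoiding_bid :: "'s set \<Rightarrow> 's \<Rightarrow> real" where
  "avoiding_bid L s = threshold L s - threshold L (best_child L s)"

text \<open>The bid \<open>0\<close> only occurs at budgets below the threshold; it makes the strategy valid there.\<close>

definition avoiding_strategy :: "'s set \<Rightarrow> player \<Rightarrow> 's strategy" where
  "avoiding_strategy L i s B =
     (if avoiding_bid L s \<le> B i then avoiding_bid L s else 0, best_child L s)"

lemma best_child:
  assumes "s \<in> states G - terminals G"
  shows "best_child L s \<in> children G s"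
    and "c \<in> children G s \<Longrightarrow> count_below L (best_child L s) \<le> count_below L c"
proof -
  have "finite (children G s)" "children G s \<noteq> {}"
    using assms two_children by (metis finite.simps insert_not_empty)+
  then show "best_child L s \<in> children G s"
    and "c \<in> children G s \<Longrightarrow> count_below L (best_child L s) \<le> count_below L c"
    unfolding best_child_def by (auto intro: arg_min_if_finite arg_min_least)
qed

text \<open>Here \<open>x\<close> is the sibling of the best child. The factor 2 arises because a
  child has half as many leaves below it as \<open>s\<close>.\<close>

lemma obtain_children:
  assumes "s \<in> states G - terminals G" "L \<subseteq> terminals G"
  obtains x where "children G s = {best_child L s, x}"
    and "count_below L s = count_below L (best_child L s) + count_below L x"
    and "count_below L (best_child L s) \<le> count_below L x"
    and "\<And>c. c \<in> children G s \<Longrightarrow> threshold L c = 2 * count_below L c / 2 ^ (k - depth s)"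
proof -
  obtain x y where xy: "children G s = {x, y}" "x \<noteq> y" using two_children assms(1) by blast
  then have "best_child L s = x \<or> best_child L s = y"
    using best_child(1)[OF assms(1), of L] by simp
  then obtain z where z: "children G s = {best_child L s, z}" "best_child L s \<noteq> z"
    using xy by (metis insert_commute)
  have "threshold L c = 2 * count_below L c / 2 ^ (k - depth s)" if "c \<in> children G s" for c
  proof -
    have "depth c = Suc (depth s)" using that assms by (intro depth_edge) (auto simp: edges_def)
    moreover have "k - depth s = Suc (k - Suc (depth s))" using depth_nonterminal assms by fastforce
    ultimately show ?thesis by (simp add: threshold_def)
  qed
  moreover have "count_below L (best_child L s) \<le> count_below L z"
    using best_child(2)[OF assms(1)] z by blast
  ultimately show thesis
    using that z count_below_children[OF assms z] by blast
qed

text \<open>The second and third facts preserve the invariant after a won and a lost bidding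
  respectively. The third holds because the mean property puts the threshold of the worse child at
  exactly \<open>threshold L s + avoiding_bid L s\<close>.\<close>

lemma avoiding_bid_bounds:
  assumes "s \<in> states G - terminals G" "L \<subseteq> terminals G"
  shows "avoiding_bid L s \<le> threshold L s"
    and "threshold L (best_child L s) = threshold L s - avoiding_bid L s"
    and "c \<in> children G s \<Longrightarrow> threshold L c \<le> threshold L s + avoiding_bid L s"
proof -
  show "avoiding_bid L s \<le> threshold L s" by (simp add: avoiding_bid_def threshold_def)
  show "threshold L (best_child L s) = threshold L s - avoiding_bid L s"
    by (simp add: avoiding_bid_def)
  obtain x where x: "children G s = {best_child L s, x}"
    "count_below L s = count_below L (best_child L s) + count_below L x"
    "count_below L (best_child L s) \<le> count_below L x"
    "\<And>c. c \<in> children G s \<Longrightarrow> threshold L c = 2 * count_below L c / 2 ^ (k - depth s)"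
    using obtain_children[OF assms] by blast
  have "threshold L s + avoiding_bid L s = 2 * count_below L x / 2 ^ (k - depth s)"
    using x by (simp add: avoiding_bid_def) (simp add: threshold_def x(2) add_divide_distrib)
  moreover assume "c \<in> children G s"
  moreover have "count_below L c \<le> count_below L x" using calculation x by auto
  ultimately show "threshold L c \<le> threshold L s + avoiding_bid L s"
    using x(4)[of c] by (auto intro!: divide_right_mono)
qed

text \<open>The bid is an integer multiple of \<open>1 / 2 ^ (k - depth s)\<close>, which the grid
  condition turns into a multiple of \<epsilon>.\<close>

lemma avoiding_bid_budget:
  assumes "s \<in> states G - terminals G" "L \<subseteq> terminals G"
    and "real n * \<epsilon> * 2 ^ k = 1" "avoiding_bid L s \<le> 1"
  shows "avoiding_bid L s \<in> budget_set \<epsilon>"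
proof -
  obtain x where x:
    "children G s = {best_child L s, x}"
    "count_below L s = count_below L (best_child L s) + count_below L x"
    "count_below L (best_child L s) \<le> count_below L x"
    "\<And>c. c \<in> children G s \<Longrightarrow> threshold L c = 2 * count_below L c / 2 ^ (k - depth s)"
    using obtain_children[OF assms(1,2)] by blast
  \<comment> \<open>The subtraction is not truncated, since the best child has the smaller
    count.\<close>
  let ?m = "count_below L x - count_below L (best_child L s)"
  have "(2::real) ^ k = 2 ^ (k - depth s) * 2 ^ depth s"
    using depth_nonterminal[OF assms(1)] by (simp flip: power_add)
  then have "1 / 2 ^ (k - depth s) = real n * \<epsilon> * 2 ^ depth s"
    using assms(3) by (simp add: field_simps)
  moreover have "avoiding_bid L s = real ?m * (1 / 2 ^ (k - depth s))"
    using x by (simp add: avoiding_bid_def)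
      (simp add: threshold_def x(2) of_nat_diff diff_divide_distrib add_divide_distrib)
  ultimately have "avoiding_bid L s = real (?m * n * 2 ^ depth s) * \<epsilon>" by simp
  then show ?thesis using assms(4) unfolding budget_set_def by blast
qed

lemma avoiding_strategy_valid:
  assumes "L \<subseteq> terminals G" "real n * \<epsilon> * 2 ^ k = 1" "\<epsilon> > 0"
  shows "valid_strategy G \<epsilon> i (avoiding_strategy L i)"
  unfolding valid_strategy_def
proof (intro ballI allI impI)
  fix s B
  assume s: "s \<in> states G - terminals G" and "budget_partition \<epsilon> B"
  then have B: "B i \<in> budget_set \<epsilon>" by (auto simp: budget_partition_def)
  \<comment> \<open>A bid of \<open>avoiding_bid L s\<close> is placed only if it is at most
    \<open>B i\<close>, so \<open>B i \<le> 1\<close> supplies the bound required by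
    \<open>avoiding_bid_budget\<close>.\<close>
  then have "0 \<le> B i" "B i \<le> 1" using assms(3) budget_set_nonneg[of \<epsilon>] by (auto simp: budget_set_def)
  moreover have "0 \<in> budget_set \<epsilon>" by (auto simp: budget_set_def)
  ultimately show "fst (avoiding_strategy L i s B) \<in> budget_set \<epsilon> \<and>
      fst (avoiding_strategy L i s B) \<le> B i \<and> snd (avoiding_strategy L i s B) \<in> children G s"
    using avoiding_bid_budget[OF s assms(1,2)] best_child(1)[OF s]
    by (auto simp: avoiding_strategy_def)
qed

section \<open>Avoidance and the equilibrium outcome\<close>

text \<open>The strict inequality between threshold and budget is an invariant of the play against
  any valid opponent.\<close>

lemma avoiding_strategy_avoids:
  assumes "L \<subseteq> terminals G" "\<epsilon> > 0"
    and valid: "\<And>j. valid_strategy G \<epsilon> j (\<sigma> j)"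
    and \<sigma>: "\<sigma> i = avoiding_strategy L i"
  shows "s \<in> states G \<Longrightarrow> budget_partition \<epsilon> B \<Longrightarrow> threshold L s < B i \<Longrightarrow>
    outcome G \<sigma> s B \<in> terminals G - L"
proof (induction "k - depth s" arbitrary: s B rule: less_induct)
  case less
  show ?case
  proof (cases "s \<in> terminals G")
    case True
    \<comment> \<open>At depth \<open>k\<close> the denominator is 1, so the count is below 1 and
      hence 0.\<close>
    then have "real (count_below L s) < B i" using less.prems by (simp add: threshold_def depth_terminal)
    moreover have "B i \<le> 1" using less.prems by (auto simp: budget_partition_def budget_set_def)
    ultimately show ?thesis
      using True count_below_terminal[of s L] assms(1) by (force simp: outcome_terminal)
  next
    case False
    with less.prems have s: "s \<in> states G - terminals G" by blast
    define b where "b = (\<lambda>j. fst (\<sigma> j s B))"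
    define w where "w = winner b"
    define c where "c = snd (\<sigma> w s B)"
    define B' where "B' = pay w (b w) B"
    have b: "b j \<in> budget_set \<epsilon>" "b j \<le> B j" and c: "c \<in> children G s" for j
      using valid s less.prems(2) unfolding valid_strategy_def b_def c_def by blast+
    note bid = avoiding_bid_bounds[OF s assms(1)]
    \<comment> \<open>The bid is at most the threshold, hence affordable, and the fallback 0 does
      not occur.\<close>
    have bi: "b i = avoiding_bid L s"
      using bid(1) less.prems(3) by (simp add: b_def \<sigma> avoiding_strategy_def)
    have "(s, c) \<in> edges G" using s c by (auto simp: edges_def)
    moreover have "k - depth c < k - depth s"
      using calculation depth_edge depth_nonterminal[OF s] by simp
    moreover have "budget_partition \<epsilon> B'"
      unfolding B'_def using b less.prems(2) assms(2) by (intro budget_partition_pay)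
    moreover have "threshold L c < B' i"
    proof (cases "w = i")
      case True
      then have "c = best_child L s" "B' i = B i - avoiding_bid L s"
        using bi by (simp_all add: c_def \<sigma> avoiding_strategy_def B'_def pay_def opponent_neq)
      then show ?thesis using bid(2) less.prems(3) by simp
    next
      case False
      then have w: "w = opponent i" by (rule neq_imp_opponent)
      \<comment> \<open>With either tie-breaking, the loser receives at least her own bid.\<close>
      then have "avoiding_bid L s \<le> b w"
        using winner_bid[of b] bi by (simp add: w_def[symmetric] opponent_opponent)
      moreover have "B' i = B i + b w"
        using w by (simp add: B'_def pay_def opponent_opponent)
      ultimately show ?thesis using bid(3)[OF c] less.prems(3) by linarith
    qed
    moreover have "outcome G \<sigma> s B = outcome G \<sigma> c B'"
      using outcome_step[OF False, of \<sigma> B]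
      by (simp add: Let_def c_def B'_def w_def b_def)
    ultimately show ?thesis using less.hyps[of c B'] edge_states by auto
  qed
qed

lemma pspe_outcome_satisfaction:
  assumes "pspe G \<epsilon> \<sigma>" "budget_partition \<epsilon> B" "real n * \<epsilon> * 2 ^ k = 1" "\<epsilon> > 0"
  shows "satisfaction_test G B (outcome G \<sigma> (root_state G) B)"
  unfolding satisfaction_test_def
proof
  fix i
  let ?o = "outcome G \<sigma> (root_state G) B"
  have T: "card (terminals G) = 2 ^ k" using full_binary by (simp add: full_binary_game_def)
  define m where "m = nat \<lceil>B i * real (card (terminals G))\<rceil>"
  define L where "L = low_ranked G i m"
  define \<sigma>' where "\<sigma>' = \<sigma>(i := avoiding_strategy L i)"
  have L: "L \<subseteq> terminals G" by (auto simp: L_def low_ranked_def)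
  have root: "root_state G \<in> states G" using tree by (simp add: rooted_tree_def)
  have "m \<le> card {t' \<in> terminals G. weakly_prefers G i ?o t'}"
  proof (cases "m = 0")
    case False
    \<comment> \<open>\<open>card L < m\<close>, and an integer below the ceiling of a real is below
      that real.\<close>
    have "real (card L) < B i * 2 ^ k"
      using card_low_ranked[OF finite_terminals, of m i] False unfolding L_def m_def T
      by simp linarith
    then have "threshold L (root_state G) < B i"
      by (simp add: threshold_def depth_root count_below_root[OF L] divide_less_eq)
    moreover have valid: "valid_strategy G \<epsilon> i (avoiding_strategy L i)"
      using avoiding_strategy_valid[OF L assms(3,4)] .
    moreover have "valid_strategy G \<epsilon> j (\<sigma>' j)" for j
      using valid assms(1) by (simp add: \<sigma>'_def pspe_def)
    ultimately have "outcome G \<sigma>' (root_state G) B \<in> terminals G - L"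
      using avoiding_strategy_avoids[OF L assms(4), of \<sigma>' i] root assms(2) by (simp add: \<sigma>'_def)
    then have "m \<le> card {t' \<in> terminals G. weakly_prefers G i (outcome G \<sigma>' (root_state G) B) t'}"
      by (auto simp: L_def low_ranked_def)
    \<comment> \<open>Switching to the avoiding strategy is no profitable deviation, so the
      equilibrium outcome ranks at least as high.\<close>
    moreover have "\<not> prefers G i (outcome G \<sigma>' (root_state G) B) ?o"
      using assms(1,2) valid root unfolding pspe_def \<sigma>'_def by blast
    ultimately show ?thesis
      using card_weakly_prefers_mono[OF finite_terminals] by (meson le_trans)
  qed simp
  then show "\<lceil>B i * real (card (terminals G))\<rceil>
      \<le> int (card {t' \<in> terminals G. weakly_prefers G i ?o t'})"
    unfolding m_def by linarith
qed

end

theorem proposition16: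
  fixes G :: "'s game" and k R :: nat and \<epsilon> :: real
    and B :: "player \<Rightarrow> real" and \<sigma> :: "player \<Rightarrow> 's strategy"
  assumes "full_binary_game k G"
    and "even R" and "R \<ge> 4"
    and "\<epsilon> = 1 / (real R * 2 ^ k)"
    and "B P1 \<in> budget_set \<epsilon>" and "B P2 = 1 - B P1"
    and "pspe G \<epsilon> \<sigma>"
  shows "satisfaction_test G B (outcome G \<sigma> (root_state G) B)"
proof -
  interpret full_binary_tree G k by unfold_locales (rule assms(1))
  have \<epsilon>: "real R * \<epsilon> * 2 ^ k = 1" "\<epsilon> > 0" using assms(3,4) by auto
  \<comment> \<open>As 1 is a grid point, so is the difference \<open>1 - B P1\<close>.\<close>
  then have "1 = real (R * 2 ^ k) * \<epsilon>" by (simp add: algebra_simps)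
  then have "1 \<in> budget_set \<epsilon>" unfolding budget_set_def by blast
  then have "B P2 \<in> budget_set \<epsilon>"
    using assms(5,6) \<epsilon>(2) budget_set_diff[of \<epsilon> 1 "B P1"] by (auto simp: budget_set_def)
  then have "budget_partition \<epsilon> B"
    unfolding budget_partition_def using assms(5,6)
    by (metis (full_types) add.commute diff_add_cancel player.exhaust)
  then show ?thesis using pspe_outcome_satisfaction assms(7) \<epsilon> by blast
qed

end
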